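(* For all $n\ge 3$ and every $n$-component conjunctive network $f$, \[ \lambda(f)\le 2n-2, \] with equality if and only if the interaction graph of $f$ is isomorphic to $C_n^\circ$.
   Context: An $n$-component (Boolean) network is a function $f=(f_1,\dots,f_n):\{0,1\}^n\to\{0,1\}^n$. Write $[n]=\{1,\dots,n\}$. The interaction graph of $f$ is the directed graph on $[n]$ (loops allowed) with an edge from $j$ to $i$ iff $f_i$ depends on $x_j$, i.e. there exist $x,y$ differing only in component $j$ with $f_i(x)\ne f_i(y)$. The network $f$ is conjunctive if for every $i\in[n]$ there is $J_i\subseteq[n]$ with $f_i(x)=\bigwedge_{j\in J_i}x_j$ for all $x$ (with $f_i\equiv 1$ if $J_i=\emptyset$). For $i\in[n]$, $f^i(x):=(x_1,\dots,x_{i-1},f_i(x),x_{i+1},\dots,x_n)$, and for a word $w=i_1i_2\dots i_k$ over $[n]$, $f^w:=f^{i_k}\circ\cdots\circ f^{i_1}$ (identity for the empty word). A word $w$ fixes $f$ if $f^w(x)$ is a fixed point of $f$ for every $x$; $\lambda(f)$ is the minimum length of a word fixing $f$. $C_n$ is the directed cycle on $[n]$ with edges $i\to i+1$ for $1\le i<n$ and $n\to 1$; $C_n^\circ$ is obtained from $C_n$ by adding a loop $i\to i$ at every vertex $i\in[n]$. *)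

theory Defs
  imports
    "HOL-Library.FuncSet"
    "HOL-Library.Extended_Nat"
    "Graph_Theory.Digraph_Isomorphism"
    "Graph_Theory.Pair_Digraph"
begin

text \<open>
  A configuration in \<open>{0,1}\<^sup>n\<close> is an extensional function on \<open>{1..n}\<close> with values in \<^typ>\<open>bool\<close>
  (\<open>True\<close> for 1), so that equality of functions is equality of configurations.
\<close>

definition configs :: "nat \<Rightarrow> (nat \<Rightarrow> bool) set" where
  "configs n = {1..n} \<rightarrow>\<^sub>E UNIV"

definition network :: "nat \<Rightarrow> ((nat \<Rightarrow> bool) \<Rightarrow> nat \<Rightarrow> bool) \<Rightarrow> bool" where
  "network n f \<longleftrightarrow> f \<in> configs n \<rightarrow> configs n"

definition depends_on :: "nat \<Rightarrow> ((nat \<Rightarrow> bool) \<Rightarrow> nat \<Rightarrow> bool) \<Rightarrow> nat \<Rightarrow> nat \<Rightarrow> bool" where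
  "depends_on n f i j \<longleftrightarrow>
     (\<exists>x\<in>configs n. \<exists>y\<in>configs n.
        x j \<noteq> y j \<and> (\<forall>k\<in>{1..n} - {j}. x k = y k) \<and> f x i \<noteq> f y i)"

definition interaction_graph ::
    "nat \<Rightarrow> ((nat \<Rightarrow> bool) \<Rightarrow> nat \<Rightarrow> bool) \<Rightarrow> nat pair_pre_digraph" where
  "interaction_graph n f =
     \<lparr>pverts = {1..n}, parcs = {(j, i). j \<in> {1..n} \<and> i \<in> {1..n} \<and> depends_on n f i j}\<rparr>"

definition conjunctive_network :: "nat \<Rightarrow> ((nat \<Rightarrow> bool) \<Rightarrow> nat \<Rightarrow> bool) \<Rightarrow> bool" where
  "conjunctive_network n f \<longleftrightarrow> network n f \<and>
     (\<forall>i\<in>{1..n}. \<exists>J\<subseteq>{1..n}. \<forall>x\<in>configs n. f x i \<longleftrightarrow> (\<forall>j\<in>J. x j))"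

definition update :: "((nat \<Rightarrow> bool) \<Rightarrow> nat \<Rightarrow> bool) \<Rightarrow> nat \<Rightarrow> (nat \<Rightarrow> bool) \<Rightarrow> nat \<Rightarrow> bool" where
  "update f i x = x(i := f x i)"

text \<open>The letters of a word are applied from left to right: the first letter is updated first.\<close>

definition update_word ::
    "((nat \<Rightarrow> bool) \<Rightarrow> nat \<Rightarrow> bool) \<Rightarrow> nat list \<Rightarrow> (nat \<Rightarrow> bool) \<Rightarrow> nat \<Rightarrow> bool" where
  "update_word f w = fold (update f) w"

definition fixing_word :: "nat \<Rightarrow> ((nat \<Rightarrow> bool) \<Rightarrow> nat \<Rightarrow> bool) \<Rightarrow> nat list \<Rightarrow> bool" where
  "fixing_word n f w \<longleftrightarrow> set w \<subseteq> {1..n} \<and>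
     (\<forall>x\<in>configs n. f (update_word f w x) = update_word f w x)"

text \<open>
  The infimum over \<^typ>\<open>enat\<close> is attained if some word fixes \<open>f\<close>, and is \<open>\<infinity>\<close> otherwise;
  hence a finite upper bound includes the existence of a fixing word.
\<close>

definition fixing_length :: "nat \<Rightarrow> ((nat \<Rightarrow> bool) \<Rightarrow> nat \<Rightarrow> bool) \<Rightarrow> enat" where
  "fixing_length n f = (INF w\<in>{w. fixing_word n f w}. enat (length w))"

definition directed_cycle :: "nat \<Rightarrow> nat pair_pre_digraph" where
  "directed_cycle n =
     \<lparr>pverts = {1..n}, parcs = {(i, i + 1) |i. 1 \<le> i \<and> i < n} \<union> {(n, 1)}\<rparr>"

definition looped_directed_cycle :: "nat \<Rightarrow> nat pair_pre_digraph" where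
  "looped_directed_cycle n =
     \<lparr>pverts = {1..n}, parcs = parcs (directed_cycle n) \<union> {(i, i) |i. i \<in> {1..n}}\<rparr>"

end

theory Submission
  imports Defs
begin

text \<open>
  Upper bound. In a strong component \<open>C\<close>, update along a spanning in-tree towards a root, leaves
  excluded, and then along a spanning out-tree from that root. If some zero is left after the first
  phase, then the root is zero, and the second phase spreads it over \<open>C\<close>; otherwise \<open>C\<close> stays
  constantly one. This costs \<open>2 |C| - 1 - l\<close> letters, where \<open>l\<close> is the number of leaves. For a strong
  graph, \<open>l \<ge> 1\<close> gives \<open>2 n - 2\<close>, and \<open>l \<ge> 2\<close> is possible as soon as some vertex has two in-neighbors
  other than itself. Otherwise the graph is a directed cycle with some loops, and a missing loop saves
  a letter because its vertex forgets its own value. A graph that is not strong is treated component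
  by component; components with incoming arcs need \<open>l = 0\<close>, since a zero may enter at a leaf.

  Lower bound. If \<open>w\<close> fixes the cycle with all loops and is shorter than \<open>2 n - 2\<close>, then three letters
  \<open>a\<close>, \<open>b\<close>, \<open>c\<close>, in this cyclic order, occur exactly once in \<open>w\<close>. A single zero at \<open>c\<close> travels through \<open>a\<close>
  and then \<open>b\<close>, so \<open>a\<close> precedes \<open>b\<close> in \<open>w\<close>; by symmetry \<open>b\<close> precedes \<open>c\<close> and \<open>c\<close> precedes \<open>a\<close>, a contradiction.
\<close>

section \<open>Asynchronous updates of conjunctive networks\<close>

text \<open>\<open>N i\<close> is the in-neighborhood of \<open>i\<close>. The argument is an
  arbitrary function, not an extensional configuration; the results are carried over to
  \<open>configs n\<close> at the end.\<close>

definition conj_map :: "(nat \<Rightarrow> nat set) \<Rightarrow> (nat \<Rightarrow> bool) \<Rightarrow> nat \<Rightarrow> bool" where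
  "conj_map N x i \<longleftrightarrow> (\<forall>j\<in>N i. x j)"

locale conjunctive =
  fixes N :: "nat \<Rightarrow> nat set"
begin

abbreviation upd :: "nat \<Rightarrow> (nat \<Rightarrow> bool) \<Rightarrow> nat \<Rightarrow> bool" where
  "upd \<equiv> update (conj_map N)"

abbreviation run :: "nat list \<Rightarrow> (nat \<Rightarrow> bool) \<Rightarrow> nat \<Rightarrow> bool" where
  "run \<equiv> update_word (conj_map N)"

text \<open>No arc enters such a set, so the values on it evolve on their own.\<close>

definition closed :: "nat set \<Rightarrow> bool" where
  "closed D \<longleftrightarrow> (\<forall>v\<in>D. N v \<subseteq> D)"

definition stable :: "nat set \<Rightarrow> (nat \<Rightarrow> bool) \<Rightarrow> bool" where
  "stable D x \<longleftrightarrow> (\<forall>v\<in>D. x v \<longleftrightarrow> (\<forall>j\<in>N v. x j))"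

text \<open>Strong connectedness, stated through cuts so that no paths are needed.\<close>

definition strong :: "nat set \<Rightarrow> bool" where
  "strong C \<longleftrightarrow> (\<forall>A\<subseteq>C. A \<noteq> {} \<longrightarrow> A \<noteq> C \<longrightarrow> (\<exists>u\<in>A. \<exists>v\<in>C - A. u \<in> N v))"

lemma upd_same: "upd v x v \<longleftrightarrow> (\<forall>j\<in>N v. x j)"
  by (simp add: update_def conj_map_def)

lemma upd_other: "u \<noteq> v \<Longrightarrow> upd v x u = x u"
  by (simp add: update_def)

lemma run_Nil [simp]: "run [] x = x"
  by (simp add: update_word_def)

lemma run_Cons [simp]: "run (v # w) x = run w (upd v x)"
  by (simp add: update_word_def)

lemma run_append [simp]: "run (u @ w) x = run w (run u x)"
  by (simp add: update_word_def)

lemma run_other: "u \<notin> set w \<Longrightarrow> run w x u = x u"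
  by (induction w arbitrary: x) (auto simp: upd_other)

text \<open>Only members of \<open>T\<close> that \<open>w\<close> updates need their in-neighbors
  in \<open>T\<close>; the others keep their one.\<close>

lemma run_ones:
  assumes "\<forall>j\<in>T. x j" "\<forall>v\<in>set w \<inter> T. N v \<subseteq> T"
  shows "\<forall>j\<in>T. run w x j"
  using assms
proof (induction w arbitrary: x)
  case (Cons v w)
  have "\<forall>j\<in>T. upd v x j"
  proof
    fix j assume "j \<in> T"
    then show "upd v x j"
      using Cons.prems by (cases "j = v") (auto simp: upd_same upd_other)
  qed
  then show ?case using Cons by auto
qed simp

text \<open>A trap for zeros: each update inside \<open>A\<close> reads a zero of
  \<open>A\<close>.\<close>

lemma run_zeros:
  assumes "\<forall>j\<in>A. \<not> x j" "\<forall>v\<in>A. N v \<inter> A \<noteq> {}"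
  shows "\<forall>j\<in>A. \<not> run w x j"
  using assms
proof (induction w arbitrary: x)
  case (Cons v w)
  have "\<forall>j\<in>A. \<not> upd v x j"
  proof
    fix j assume "j \<in> A"
    then show "\<not> upd v x j"
      using Cons.prems by (cases "j = v") (simp add: upd_same, blast, simp add: upd_other)
  qed
  then show ?case using Cons by auto
qed simp

lemma stable_cong:
  assumes "stable D x" "closed D" "\<forall>j\<in>D. y j = x j"
  shows "stable D y"
  using assms unfolding stable_def closed_def by (metis subsetD)

lemma stable_run_disjoint:
  assumes "stable D x" "closed D" "set w \<inter> D = {}"
  shows "stable D (run w x)"
  by (rule stable_cong[OF assms(1,2)]) (use assms(3) run_other in blast)

lemma stable_Un: "stable C x \<Longrightarrow> stable D x \<Longrightarrow> stable (C \<union> D) x"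
  by (auto simp: stable_def)

section \<open>Gathering zeros along an in-tree\<close>

text \<open>An in-tree listed children first: the later \<open>v\<close> can serve as parent of
  \<open>u\<close>, and the last entry is the root.\<close>

primrec gather_order :: "nat list \<Rightarrow> bool" where
  "gather_order [] \<longleftrightarrow> True"
| "gather_order (u # us) \<longleftrightarrow> (us = [] \<or> (\<exists>v\<in>set us. u \<in> N v)) \<and> gather_order us"

text \<open>The second conjunct drives the induction: once \<open>u\<close> has turned zero, it is,
  for the rest of the list, an outside zero with an out-neighbor in that list.\<close>

lemma gather:
  assumes "gather_order U" "distinct U" "U \<noteq> []"
  shows "(\<forall>u\<in>set U. \<not> run U x u \<longrightarrow> \<not> run U x (last U)) \<and>
    (\<forall>p. p \<notin> set U \<longrightarrow> \<not> x p \<longrightarrow> (\<exists>v\<in>set U. p \<in> N v) \<longrightarrow> \<not> run U x (last U))"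
  using assms
proof (induction U arbitrary: x)
  case (Cons u us)
  have u: "run (u # us) x u \<longleftrightarrow> (\<forall>j\<in>N u. x j)"
    using Cons.prems by (simp add: run_other upd_same)
  show ?case
  proof (cases "us = []")
    case True
    then show ?thesis using u by auto
  next
    case False
    then have IH: "\<forall>v\<in>set us. \<not> run us (upd u x) v \<longrightarrow> \<not> run us (upd u x) (last us)"
      "\<And>p. p \<notin> set us \<Longrightarrow> \<not> upd u x p \<Longrightarrow> \<exists>v\<in>set us. p \<in> N v \<Longrightarrow> \<not> run us (upd u x) (last us)"
      using Cons.IH[of "upd u x"] Cons.prems by auto
    obtain v where v: "v \<in> set us" "u \<in> N v"
      using Cons.prems False by auto
    have first: "\<not> run us (upd u x) (last us)" if "\<not> (\<forall>j\<in>N u. x j)"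
      using IH(2)[of u] that v Cons.prems upd_same by auto
    show ?thesis
    proof (intro conjI ballI allI impI)
      fix z assume "z \<in> set (u # us)" "\<not> run (u # us) x z"
      then show "\<not> run (u # us) x (last (u # us))"
        using IH(1) u first False by auto
    next
      fix p assume p: "p \<notin> set (u # us)" "\<not> x p" "\<exists>v\<in>set (u # us). p \<in> N v"
      then show "\<not> run (u # us) x (last (u # us))"
        using IH(2)[of p] first False upd_other[of p u] by auto
    qed
  qed
qed simp

text \<open>A vertex of \<open>P\<close> is not updated by \<open>U\<close>, so its zero was there
  initially and is picked up by an out-neighbor in \<open>U\<close>.\<close>

lemma gather_zeros:
  assumes "gather_order U" "distinct (P @ U)" "U \<noteq> []" "\<forall>p\<in>set P. \<exists>v\<in>set U. p \<in> N v"
    and "u \<in> set (P @ U)" "\<not> run U x u"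
  shows "\<not> run U x (last U)"
proof (cases "u \<in> set U")
  case True
  then show ?thesis using gather[of U x] assms by auto
next
  case False
  then have "u \<in> set P" "\<not> x u" using assms run_other by auto
  then show ?thesis using gather[of U x] assms False by simp
qed

text \<open>The tree grows against the arcs while the number of reserved leaves stays the same. The
  premise \<open>cut\<close> concerns only sets containing the root, so it also serves a set that
  need not be strong, as in \<open>loopless_fixing_word\<close>.\<close>

lemma gather_order_exists:
  assumes "finite C" "gather_order U" "distinct (P @ U)" "U \<noteq> []" "set (P @ U) \<subseteq> C"
    and "\<forall>p\<in>set P. \<exists>v\<in>set U. p \<in> N v"
    and cut: "\<And>A. A \<subseteq> C \<Longrightarrow> last U \<in> A \<Longrightarrow> A \<noteq> C \<Longrightarrow> \<exists>u\<in>C - A. \<exists>v\<in>A. u \<in> N v"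
  shows "\<exists>P' U'. gather_order U' \<and> distinct (P' @ U') \<and> U' \<noteq> [] \<and> last U' = last U \<and>
    set (P' @ U') = C \<and> length P' = length P \<and> (\<forall>p\<in>set P'. \<exists>v\<in>set U'. p \<in> N v)"
  using assms(2-)
proof (induction "card (C - set (P @ U))" arbitrary: P U rule: less_induct)
  case less
  show ?case
  proof (cases "set (P @ U) = C")
    case True
    then show ?thesis using less.prems by blast
  next
    case False
    have "last U \<in> set (P @ U)" using less.prems by simp
    then obtain u v where uv: "u \<in> C - set (P @ U)" "v \<in> set (P @ U)" "u \<in> N v"
      using less.prems(6)[OF less.prems(4)] False by blast
    have dec: "card (C - insert u (set (P @ U))) < card (C - set (P @ U))"
      by (rule psubset_card_mono) (use \<open>finite C\<close> uv in auto)
    \<comment> \<open>If the arc ends in \<open>U\<close>, the new vertex \<open>u\<close> goes in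
      front of \<open>U\<close>. If it ends in a leaf \<open>v\<close>, then \<open>v\<close>
      becomes an inner vertex and \<open>u\<close> replaces it as a leaf.\<close>
    show ?thesis
    proof (cases "v \<in> set U")
      case True
      have "\<exists>P' U'. gather_order U' \<and> distinct (P' @ U') \<and> U' \<noteq> [] \<and> last U' = last (u # U) \<and>
        set (P' @ U') = C \<and> length P' = length P \<and> (\<forall>p\<in>set P'. \<exists>v\<in>set U'. p \<in> N v)"
        by (rule less.hyps) (use less.prems uv True dec in auto)
      then show ?thesis using less.prems by simp
    next
      case v: False
      then have "v \<in> set P" using uv by simp
      then obtain P1 P2 where P: "P = P1 @ v # P2" by (auto dest: split_list)
      have set_eq: "set ((P1 @ u # P2) @ v # U) = insert u (set (P @ U))" using P by auto
      have "\<exists>P' U'. gather_order U' \<and> distinct (P' @ U') \<and> U' \<noteq> [] \<and> last U' = last (v # U) \<and>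
        set (P' @ U') = C \<and> length P' = length (P1 @ u # P2) \<and> (\<forall>p\<in>set P'. \<exists>v\<in>set U'. p \<in> N v)"
      proof (rule less.hyps)
        show "card (C - set ((P1 @ u # P2) @ v # U)) < card (C - set (P @ U))"
          using set_eq dec by simp
        show "gather_order (v # U)" using less.prems P by simp
        show "distinct ((P1 @ u # P2) @ v # U)" using less.prems(2) P uv(1) by auto
        show "set ((P1 @ u # P2) @ v # U) \<subseteq> C" using set_eq less.prems(4) uv(1) by auto
        show "\<forall>p\<in>set (P1 @ u # P2). \<exists>va\<in>set (v # U). p \<in> N va"
          using less.prems(5) P uv(3) by auto
        show "\<exists>u\<in>C - A. \<exists>v\<in>A. u \<in> N v" if "A \<subseteq> C" "last (v # U) \<in> A" "A \<noteq> C" for A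
          using less.prems(3,6) that by simp
      qed simp
      then show ?thesis using less.prems P by simp
    qed
  qed
qed

section \<open>Spreading zeros along an out-tree\<close>

text \<open>An out-tree listed parents first, grown from the vertices of \<open>A\<close>.\<close>

primrec spread_order :: "nat set \<Rightarrow> nat list \<Rightarrow> bool" where
  "spread_order A [] \<longleftrightarrow> True"
| "spread_order A (s # ss) \<longleftrightarrow> N s \<inter> A \<noteq> {} \<and> spread_order (insert s A) ss"

lemma spread:
  assumes "spread_order A S" "\<forall>v\<in>A. \<not> x v"
  shows "\<forall>v\<in>A \<union> set S. \<not> run S x v"
  using assms
proof (induction S arbitrary: x A)
  case (Cons s S)
  have "\<not> upd s x v" if "v \<in> insert s A" for v
    using Cons.prems that by (cases "v = s") (auto simp: upd_same upd_other)
  then have "\<forall>v\<in>insert s A \<union> set S. \<not> run S (upd s x) v"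
    using Cons.IH[of "insert s A" "upd s x"] Cons.prems by auto
  then show ?case by auto
qed simp

lemma spread_order_exists:
  assumes "finite C" "strong C" "A \<subseteq> C" "A \<noteq> {}"
  shows "\<exists>S. spread_order A S \<and> set S = C - A \<and> length S = card (C - A)"
  using assms(3,4)
proof (induction "card (C - A)" arbitrary: A rule: less_induct)
  case less
  show ?case
  proof (cases "A = C")
    case True
    then show ?thesis by (intro exI[of _ "[]"]) auto
  next
    case False
    then obtain u s where us: "u \<in> A" "s \<in> C - A" "u \<in> N s"
      using less.prems \<open>strong C\<close> unfolding strong_def by blast
    have card: "card (C - A) = Suc (card (C - insert s A))"
      using us \<open>finite C\<close> by (metis Diff_insert card_Suc_Diff1 finite_Diff)
    obtain S where S: "spread_order (insert s A) S" "set S = C - insert s A"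
        "length S = card (C - insert s A)"
      using less.hyps[of "insert s A"] less.prems us card by auto
    show ?thesis
      by (rule exI[of _ "s # S"]) (use S us card in auto)
  qed
qed

section \<open>Fixing a strong component\<close>

lemma strong_has_in_neighbor:
  assumes "strong C" "v \<in> C" "C \<noteq> {v}"
  shows "N v \<inter> (C - {v}) \<noteq> {}"
proof -
  have "\<exists>u\<in>C - {v}. \<exists>w\<in>C - (C - {v}). u \<in> N w"
    using assms(1)[unfolded strong_def, rule_format, of "C - {v}"] assms(2,3) by blast
  then show ?thesis using assms(2) by auto
qed

lemma strong_cut_into:
  assumes "strong C" "A \<subseteq> C" "A \<noteq> {}" "A \<noteq> C"
  shows "\<exists>u\<in>C - A. \<exists>v\<in>A. u \<in> N v"
proof -
  have "C - A \<subseteq> C" "C - A \<noteq> {}" "C - A \<noteq> C" using assms by auto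
  then obtain u v where "u \<in> C - A" "v \<in> C - (C - A)" "u \<in> N v"
    using assms(1) unfolding strong_def by metis
  then show ?thesis by auto
qed

text \<open>The vertices of \<open>P\<close> are leaves of the in-tree; they save one letter each, but a zero entering
  a leaf from outside the component would go unnoticed, whence the condition on \<open>P\<close>.\<close>

lemma strong_fixing_word:
  assumes "finite C" "strong C" "\<forall>v\<in>C. N v \<inter> C \<noteq> {}"
    and "gather_order U" "distinct (P @ U)" "U \<noteq> []" "set (P @ U) \<subseteq> C"
    and "\<forall>p\<in>set P. \<exists>v\<in>set U. p \<in> N v"
  shows "\<exists>w. set w \<subseteq> C \<and> length w \<le> 2 * card C - 1 - length P \<and>
    (\<forall>x. (P = [] \<or> (\<forall>v\<in>C. \<forall>j\<in>N v - C. x j)) \<longrightarrow> stable C (run w x))"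
proof -
  obtain P' U' where PU: "gather_order U'" "distinct (P' @ U')" "U' \<noteq> []"
      "set (P' @ U') = C" "length P' = length P" "\<forall>p\<in>set P'. \<exists>v\<in>set U'. p \<in> N v"
    using gather_order_exists[OF assms(1,4-8)] strong_cut_into[OF assms(2)] by blast
  define r where "r = last U'"
  have r: "r \<in> set U'" "r \<in> C" using PU r_def by auto
  obtain S where S: "spread_order {r} S" "set S = C - {r}" "length S = card (C - {r})"
    using spread_order_exists[OF assms(1,2), of "{r}"] r by auto
  have "card C = length P + length U'"
    using PU(2,4,5) distinct_card[of "P' @ U'"] by simp
  moreover have "length S = card C - 1" using S r assms(1) by simp
  moreover have "card C > 0" using r assms(1) card_gt_0_iff by blast
  ultimately have len: "length (U' @ S) \<le> 2 * card C - 1 - length P" by simp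
  have "stable C (run (U' @ S) x)" if ext: "P = [] \<or> (\<forall>v\<in>C. \<forall>j\<in>N v - C. x j)" for x
  proof -
    define y where "y = run U' x"
    have gath: "\<not> y r" if "u \<in> C" "\<not> y u" for u
      using gather_zeros[of U' P' u x] PU that unfolding y_def r_def by auto
    show ?thesis
    proof (cases "y r")
      case False
      then have "\<forall>v\<in>{r} \<union> set S. \<not> run S y v" using spread[OF S(1), of y] by simp
      then have "\<forall>v\<in>C. \<not> run (U' @ S) x v" using S(2) y_def by simp
      then show ?thesis using assms(3) unfolding stable_def by blast
    next
      case True
      then have ones: "\<forall>v\<in>C. y v" using gath by blast
      \<comment> \<open>Without leaves the first phase updates all of \<open>C\<close>, so by
        \<open>gather\<close> a zero entering from outside would have reached the root.\<close>
      have ext': "\<forall>v\<in>C. \<forall>j\<in>N v - C. x j"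
      proof (cases "P = []")
        case True
        then have "set U' = C" using PU by simp
        then show ?thesis using gather[of U' x] PU \<open>y r\<close> unfolding y_def r_def by auto
      qed (use ext in simp)
      have "\<forall>j\<in>C \<union> (\<Union>v\<in>C. N v). y j"
        using ones ext' run_other[of _ U' x] PU(4) unfolding y_def
        by (metis DiffI UN_iff UnE Un_upper2 set_append subsetD)
      then have "\<forall>j\<in>C \<union> (\<Union>v\<in>C. N v). run S y j"
        by (rule run_ones) (use S(2) in auto)
      then show ?thesis unfolding stable_def y_def by auto
    qed
  qed
  then show ?thesis using len PU(4) S(2) by (intro exI[of _ "U' @ S"]) auto
qed

section \<open>Graphs that are not strong, component by component\<close>

lemma component_exists:
  assumes "finite V" "closed V" "closed D" "D \<subset> V"
  shows "\<exists>C. C \<noteq> {} \<and> C \<subseteq> V - D \<and> closed (C \<union> D) \<and> strong C"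
proof -
  define F where "F = {C. C \<noteq> {} \<and> C \<subseteq> V - D \<and> closed (C \<union> D)}"
  have "(V - D) \<union> D = V" using assms(4) by auto
  then have "V - D \<in> F" using assms unfolding F_def by auto
  moreover have "finite F"
    by (rule finite_subset[of _ "Pow V"]) (use \<open>finite V\<close> F_def in auto)
  ultimately obtain C where C: "C \<in> F" "\<forall>B\<in>F. B \<subseteq> C \<longrightarrow> C = B"
    using finite_has_minimal[of F] by blast
  \<comment> \<open>By minimality \<open>C - A \<union> D\<close> is not closed. As \<open>D\<close>
    and \<open>C \<union> D\<close> are, some vertex of \<open>C - A\<close> has an in-neighbor in
    \<open>A\<close>.\<close>
  have "strong C"
    unfolding strong_def
  proof (intro allI impI)
    fix A assume A: "A \<subseteq> C" "A \<noteq> {}" "A \<noteq> C"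
    then have "C - A \<notin> F" using C(2) by blast
    then have "\<not> closed (C - A \<union> D)" using A C(1) unfolding F_def by blast
    then show "\<exists>u\<in>A. \<exists>v\<in>C - A. u \<in> N v"
      using C(1) \<open>closed D\<close> unfolding F_def closed_def by blast
  qed
  then show ?thesis using C(1) F_def by blast
qed

text \<open>The in-tree starts as a star with root \<open>r\<close> and leaves \<open>P\<close>. As
  \<open>w\<close> stays in \<open>C\<close>, it cannot disturb the closed set
  \<open>D\<close>.\<close>

lemma strong_gather_word:
  assumes "finite C" "strong C" "r \<in> C" "distinct (P @ [r])" "set P \<subseteq> N r \<inter> C" "N r \<inter> C \<noteq> {}"
    and "closed D" "C \<inter> D = {}"
  shows "\<exists>w. set w \<subseteq> C \<and> length w \<le> 2 * card C - 1 - length P \<and>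
    (\<forall>x. stable D x \<longrightarrow> P = [] \<or> (\<forall>v\<in>C. \<forall>j\<in>N v - C. x j) \<longrightarrow> stable (C \<union> D) (run w x))"
proof -
  have loops: "\<forall>v\<in>C. N v \<inter> C \<noteq> {}"
    using strong_has_in_neighbor[OF assms(2)] assms(3,6) by blast
  have "\<exists>w. set w \<subseteq> C \<and> length w \<le> 2 * card C - 1 - length P \<and>
    (\<forall>x. (P = [] \<or> (\<forall>v\<in>C. \<forall>j\<in>N v - C. x j)) \<longrightarrow> stable C (run w x))"
    by (rule strong_fixing_word[of _ "[r]"]) (use assms loops in auto)
  then obtain w where w: "set w \<subseteq> C" "length w \<le> 2 * card C - 1 - length P"
      "\<And>x. (P = [] \<or> (\<forall>v\<in>C. \<forall>j\<in>N v - C. x j)) \<Longrightarrow> stable C (run w x)"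
    by blast
  have "stable D (run w x)" if "stable D x" for x
    using stable_run_disjoint[OF that assms(7)] w(1) assms(8) by blast
  then show ?thesis using w stable_Un by blast
qed

text \<open>No leaf is reserved, so arbitrary values may enter from outside. A single vertex without
  a loop takes one letter, which is \<open>2 * 1 - 1\<close>.\<close>

lemma component_fixing_word:
  assumes "finite C" "strong C" "C \<noteq> {}" "closed D" "C \<inter> D = {}"
  shows "\<exists>w. set w \<subseteq> C \<and> length w \<le> 2 * card C - 1 \<and>
    (\<forall>x. stable D x \<longrightarrow> stable (C \<union> D) (run w x))"
proof -
  obtain r where r: "r \<in> C" using assms by blast
  show ?thesis
  proof (cases "N r \<inter> C = {}")
    case False
    then show ?thesis
      using strong_gather_word[of C r "[]" D] assms r by simp
  next
    case True
    then have C: "C = {r}" using strong_has_in_neighbor[OF assms(2) r] by blast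
    have "stable (C \<union> D) (run [r] x)" if "stable D x" for x
    proof (rule stable_Un)
      have "r \<notin> N r" using True r by blast
      then have "\<forall>j\<in>N r. upd r x j = x j" using upd_other by metis
      then show "stable C (run [r] x)" unfolding stable_def C by (simp add: upd_same)
      show "stable D (run [r] x)"
        using stable_run_disjoint[OF that assms(4), of "[r]"] assms(5) r by auto
    qed
    then show ?thesis using C by (intro exI[of _ "[r]"]) simp
  qed
qed

text \<open>One reserved leaf saves a letter, at the price that only ones enter from outside. A
  single vertex with a loop has no leaf to offer, but is then stable already.\<close>

lemma component_fixing_word_short:
  assumes "finite C" "strong C" "r \<in> C" "N r \<inter> C \<noteq> {}" "closed D" "C \<inter> D = {}"
  shows "\<exists>w. set w \<subseteq> C \<and> length w \<le> 2 * card C - 2 \<and>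
    (\<forall>x. stable D x \<longrightarrow> (\<forall>v\<in>C. \<forall>j\<in>N v - C. x j) \<longrightarrow> stable (C \<union> D) (run w x))"
proof (cases "C = {r}")
  case True
  have "stable (C \<union> D) x" if "stable D x" "\<forall>v\<in>C. \<forall>j\<in>N v - C. x j" for x
    by (rule stable_Un) (use that True assms(4) in \<open>auto simp: stable_def\<close>)
  then show ?thesis by (intro exI[of _ "[]"]) simp
next
  case False
  then obtain a where "a \<in> N r \<inter> (C - {r})"
    using strong_has_in_neighbor assms by blast
  then show ?thesis
    using strong_gather_word[of C r "[a]" D] assms by auto
qed

text \<open>Components are settled in topological order, undisturbed by later ones. Truncated
  subtraction makes the bound 0 once \<open>D = V\<close>.\<close>

lemma completing_word:
  assumes "finite V" "closed V" "closed D" "D \<subseteq> V"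
  shows "\<exists>w. set w \<subseteq> V - D \<and> length w \<le> 2 * card (V - D) - 1 \<and>
    (\<forall>x. stable D x \<longrightarrow> stable V (run w x))"
  using assms(3,4)
proof (induction "card (V - D)" arbitrary: D rule: less_induct)
  case less
  show ?case
  proof (cases "D = V")
    case True
    then show ?thesis by (intro exI[of _ "[]"]) simp
  next
    case False
    then have "D \<subset> V" using less.prems by blast
    then obtain C where C: "C \<noteq> {}" "C \<subseteq> V - D" "closed (C \<union> D)" "strong C"
      using component_exists[OF assms(1,2) less.prems(1)] by blast
    have fin: "finite C" using C(2) assms(1) finite_subset by blast
    have card: "card (V - D) = card C + card (V - (C \<union> D))" "card C > 0"
    proof -
      have "V - D = C \<union> (V - (C \<union> D))" using C(2) by blast
      then show "card (V - D) = card C + card (V - (C \<union> D))"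
        using card_Un_disjoint[of C "V - (C \<union> D)"] fin assms(1) by auto
      show "card C > 0" using fin C(1) card_gt_0_iff by blast
    qed
    obtain w where w: "set w \<subseteq> C" "length w \<le> 2 * card C - 1"
        "\<And>x. stable D x \<Longrightarrow> stable (C \<union> D) (run w x)"
      using component_fixing_word[OF fin C(4,1) less.prems(1)] C(2) by blast
    obtain w' where w': "set w' \<subseteq> V - (C \<union> D)" "length w' \<le> 2 * card (V - (C \<union> D)) - 1"
        "\<And>x. stable (C \<union> D) x \<Longrightarrow> stable V (run w' x)"
      using less.hyps[of "C \<union> D"] card C less.prems by auto
    show ?thesis
      by (rule exI[of _ "w @ w'"]) (use w w' card C(2) in auto)
  qed
qed

text \<open>Nothing enters the first component \<open>C\<close>. If it contains an arc, a leaf may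
  be reserved there, which saves two letters against two per vertex, and the rest saves a third.
  Otherwise \<open>C\<close> is a vertex whose function is constantly one.\<close>

lemma not_strong_fixing_word:
  assumes "finite V" "closed V" "card V \<ge> 3" "\<not> strong V"
  shows "\<exists>w. set w \<subseteq> V \<and> length w \<le> 2 * card V - 3 \<and> (\<forall>x. stable V (run w x))"
proof -
  have empty: "closed {}" "stable {} x" for x by (auto simp: closed_def stable_def)
  have "V \<noteq> {}" using assms(3) by auto
  obtain C where C: "C \<noteq> {}" "C \<subseteq> V" "closed C" "strong C"
    using component_exists[OF assms(1,2) empty(1)] \<open>V \<noteq> {}\<close> by auto
  have fin: "finite C" using C(2) assms(1) finite_subset by blast
  have "C \<noteq> V" using C(4) assms(4) by blast
  have cardV: "card V = card C + card (V - C)" "card C > 0" "card (V - C) > 0"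
  proof -
    show "card V = card C + card (V - C)"
      using fin C(2) assms(1) by (simp add: card_Diff_subset card_mono)
    show "card C > 0" "card (V - C) > 0"
      using fin C(1,2) \<open>C \<noteq> V\<close> assms(1) by (auto simp: card_gt_0_iff)
  qed
  obtain r where r: "r \<in> C" using C by blast
  show ?thesis
  proof (cases "N r \<inter> C = {}")
    case False
    obtain w where w: "set w \<subseteq> C" "length w \<le> 2 * card C - 2"
      "\<And>x. stable {} x \<Longrightarrow> (\<forall>v\<in>C. \<forall>j\<in>N v - C. x j) \<Longrightarrow> stable (C \<union> {}) (run w x)"
      using component_fixing_word_short[OF fin C(4) r False empty(1)] by blast
    obtain w' where w': "set w' \<subseteq> V - C" "length w' \<le> 2 * card (V - C) - 1"
      "\<And>x. stable C x \<Longrightarrow> stable V (run w' x)"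
      using completing_word[OF assms(1,2) C(3,2)] by blast
    have "stable C (run w x)" for x
      using w(3)[of x] empty(2) C(3) unfolding closed_def by auto
    then show ?thesis
      by (intro exI[of _ "w @ w'"]) (use w w' cardV C(2) in auto)
  next
    case True
    then have C_eq: "C = {r}" using strong_has_in_neighbor[OF C(4) r] by blast
    then have Nr: "N r = {}" using True C(3) unfolding closed_def by blast
    have stable_r: "stable C x \<longleftrightarrow> x r" for x unfolding stable_def C_eq using Nr by simp
    have first: "stable C (run [r] x)" for x unfolding stable_r by (simp add: upd_same Nr)
    obtain B where B: "B \<noteq> {}" "B \<subseteq> V - C" "closed (B \<union> C)" "strong B"
      using component_exists[OF assms(1,2) C(3)] C(2) \<open>C \<noteq> V\<close> by blast
    have finB: "finite B" using B(2) assms(1) finite_subset by blast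
    have disj: "B \<inter> C = {}" using B(2) by blast
    have cardC: "card C = 1" using C_eq by simp
    \<comment> \<open>The three savings: one at \<open>r\<close>, and then either two on a single
      remaining component \<open>B\<close>, or one each on \<open>B\<close> and on the vertices
      after it.\<close>
    show ?thesis
    proof (cases "B \<union> C = V")
      case True
      then have VC: "V - C = B" using disj by blast
      obtain b where b: "b \<in> B" using B by blast
      have "B \<noteq> {b}"
      proof
        assume "B = {b}"
        then show False using VC cardV(1) cardC assms(3) by simp
      qed
      then have "N b \<inter> B \<noteq> {}" using strong_has_in_neighbor[OF B(4) b] by blast
      then obtain w where w: "set w \<subseteq> B" "length w \<le> 2 * card B - 2"
        "\<And>x. stable C x \<Longrightarrow> (\<forall>v\<in>B. \<forall>j\<in>N v - B. x j) \<Longrightarrow> stable (B \<union> C) (run w x)"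
        using component_fixing_word_short[OF finB B(4) b _ C(3) disj] by blast
      \<comment> \<open>From outside, \<open>B\<close> is entered only from \<open>r\<close>, which
        is one after the first letter.\<close>
      have "N v - B \<subseteq> {r}" if "v \<in> B" for v
        using that B(3) C_eq unfolding closed_def by blast
      then have "stable V (run w x)" if "stable C x" for x
        using w(3)[OF that] that stable_r True by blast
      then show ?thesis
        by (intro exI[of _ "r # w"])
          (use first w cardV VC cardC True C_eq assms(3) in auto)
    next
      case False
      obtain w where w: "set w \<subseteq> B" "length w \<le> 2 * card B - 1"
        "\<And>x. stable C x \<Longrightarrow> stable (B \<union> C) (run w x)"
        using component_fixing_word[OF finB B(4,1) C(3) disj] by blast
      have sub: "B \<union> C \<subseteq> V" using B(2) C(2) by blast
      obtain w' where w': "set w' \<subseteq> V - (B \<union> C)" "length w' \<le> 2 * card (V - (B \<union> C)) - 1"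
        "\<And>x. stable (B \<union> C) x \<Longrightarrow> stable V (run w' x)"
        using completing_word[OF assms(1,2) B(3) sub] by blast
      have "V - C = B \<union> (V - (B \<union> C))" using B(2) by blast
      then have "card (V - C) = card B + card (V - (B \<union> C))"
        using card_Un_disjoint[of B "V - (B \<union> C)"] finB assms(1) by auto
      moreover have "card B > 0" "card (V - (B \<union> C)) > 0"
        using finB B(1) assms(1) False sub by (auto simp: card_gt_0_iff)
      ultimately have "length (r # w @ w') \<le> 2 * card V - 3"
        using w(2) w'(2) cardV(1) cardC by simp
      then show ?thesis
        by (intro exI[of _ "r # w @ w'"]) (use first w w' sub C_eq in auto)
    qed
  qed
qed

text \<open>Spreading starts with \<open>s\<close>, which has no loop and thereby forgets its own initial value;
  hence gathering need not visit \<open>s\<close>.\<close>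

lemma loopless_fixing_word:
  assumes "finite V" "closed V" "strong V" "card V \<ge> 3" "s \<in> V" "r \<in> V" "r \<noteq> s" "N s = {r}"
  shows "\<exists>w. set w \<subseteq> V \<and> length w \<le> 2 * card V - 3 \<and> (\<forall>x. stable V (run w x))"
proof -
  define C where "C = V - {s}"
  have C: "C \<subseteq> V" "finite C" "r \<in> C" "card C = card V - 1"
    using assms C_def by auto
  \<comment> \<open>The cut is applied to \<open>insert s A\<close>: the arc found does not end in
    \<open>s\<close>, whose only in-neighbor \<open>r\<close> lies in \<open>A\<close>.\<close>
  have cut: "\<exists>u\<in>C - A. \<exists>v\<in>A. u \<in> N v" if A: "A \<subseteq> C" "r \<in> A" "A \<noteq> C" for A
  proof -
    have "insert s A \<subseteq> V" "insert s A \<noteq> V" using A assms(5) C_def by auto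
    then obtain u v where "u \<in> V - insert s A" "v \<in> insert s A" "u \<in> N v"
      using strong_cut_into[OF assms(3), of "insert s A"] by blast
    then show ?thesis using A(2) assms(8) C_def by auto
  qed
  have "C \<noteq> {r}"
  proof
    assume "C = {r}"
    then show False using C(4) assms(4) by simp
  qed
  then obtain a where a: "a \<in> C - {r}" "a \<in> N r"
    using cut[of "{r}"] C(3) by auto
  have "\<exists>P U. gather_order U \<and> distinct (P @ U) \<and> U \<noteq> [] \<and> last U = last [r] \<and>
    set (P @ U) = C \<and> length P = length [a] \<and> (\<forall>p\<in>set P. \<exists>v\<in>set U. p \<in> N v)"
    by (rule gather_order_exists) (use C a cut in auto)
  then obtain P U where PU: "gather_order U" "distinct (P @ U)" "U \<noteq> []" "last U = r"
      "set (P @ U) = C" "length P = 1" "\<forall>p\<in>set P. \<exists>v\<in>set U. p \<in> N v"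
    by auto
  obtain S where S: "spread_order {s, r} S" "set S = V - {s, r}" "length S = card (V - {s, r})"
    using spread_order_exists[OF assms(1,3), of "{s, r}"] assms(5,6) by auto
  have order: "spread_order {r} (s # S)" using S(1) assms(8) by simp
  \<comment> \<open>\<open>U\<close> omits \<open>s\<close> and one leaf, \<open>S\<close> omits
    \<open>s\<close> and \<open>r\<close>; the letter \<open>s\<close> itself makes it
    \<open>2 * card V - 3\<close>.\<close>
  have "card (V - {s, r}) = card V - 2"
    using assms(1,5,6,7) by (simp add: card_Diff_subset)
  moreover have "length U = card V - 2"
    using PU(2,5,6) distinct_card[of "P @ U"] C(4) by simp
  ultimately have len: "length (U @ s # S) \<le> 2 * card V - 3"
    using S(3) assms(4) by simp
  have "stable V (run (U @ s # S) x)" for x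
  proof -
    define y where "y = run U x"
    have gath: "\<not> y r" if "u \<in> C" "\<not> y u" for u
      using gather_zeros[of U P u x] PU that unfolding y_def by auto
    show ?thesis
    proof (cases "y r")
      case False
      then have "\<forall>v\<in>{r} \<union> set (s # S). \<not> run (s # S) y v" using spread[OF order, of y] by simp
      then have "\<forall>v\<in>V. \<not> run (U @ s # S) x v" using S(2) y_def by auto
      moreover have "\<forall>v\<in>V. N v \<inter> V \<noteq> {}"
        using strong_has_in_neighbor[OF assms(3)] assms(5,6,7) by blast
      ultimately show ?thesis unfolding stable_def by blast
    next
      case True
      then have "\<forall>v\<in>C. y v" using gath by blast
      \<comment> \<open>\<open>s\<close> reads \<open>r\<close> alone, so it becomes one whatever it
        was.\<close>
      then have "\<forall>v\<in>V. upd s y v"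
        using True assms(8) upd_other[of _ s y] upd_same[of s y] C_def by (metis Diff_iff singletonD)
      then have "\<forall>v\<in>V. run S (upd s y) v"
        by (rule run_ones) (use assms(2) closed_def in blast)
      then show ?thesis using assms(2) unfolding stable_def closed_def y_def by auto
    qed
  qed
  then show ?thesis using len S(2) PU(5) C(1) assms(5)
    by (intro exI[of _ "U @ s # S"]) auto
qed

section \<open>Dichotomy between a short word and the looped cycle\<close>

lemma short_fixing_word_or_looped_cycle:
  assumes "finite V" "closed V" "card V \<ge> 3"
  shows "(\<exists>w. set w \<subseteq> V \<and> length w \<le> 2 * card V - 3 \<and> (\<forall>x. stable V (run w x))) \<or>
    (strong V \<and> (\<forall>v\<in>V. \<exists>p\<in>V. p \<noteq> v \<and> N v = {v, p}))"
proof (rule disjCI)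
  assume *: "\<not> (strong V \<and> (\<forall>v\<in>V. \<exists>p\<in>V. p \<noteq> v \<and> N v = {v, p}))"
  show "\<exists>w. set w \<subseteq> V \<and> length w \<le> 2 * card V - 3 \<and> (\<forall>x. stable V (run w x))"
  proof (cases "strong V")
    case False
    then show ?thesis using not_strong_fixing_word assms by blast
  next
    case True
    then obtain v where v: "v \<in> V" "\<not> (\<exists>p\<in>V. p \<noteq> v \<and> N v = {v, p})" using * by blast
    have "V \<noteq> {v}" using assms(3) by auto
    then obtain a where a: "a \<in> N v" "a \<in> V" "a \<noteq> v"
      using strong_has_in_neighbor[OF True v(1)] by blast
    have Nv: "N v \<subseteq> V" using assms(2) v(1) closed_def by blast
    show ?thesis
    proof (cases "N v \<subseteq> {v, a}")
      case True
      then have "N v = {a}" using v(2) a by blast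
      then show ?thesis using loopless_fixing_word[of V v a] assms a v(1) \<open>strong V\<close> by blast
    next
      case False
      then obtain b where b: "b \<in> N v" "b \<noteq> v" "b \<noteq> a" by blast
      \<comment> \<open>\<open>a\<close> and \<open>b\<close> are two leaves at the root
        \<open>v\<close>.\<close>
      have "\<exists>w. set w \<subseteq> V \<and> length w \<le> 2 * card V - 1 - length [a, b] \<and>
        (\<forall>x. stable {} x \<longrightarrow> [a, b] = [] \<or> (\<forall>v\<in>V. \<forall>j\<in>N v - V. x j) \<longrightarrow> stable (V \<union> {}) (run w x))"
        by (rule strong_gather_word) (use assms True v a b Nv in \<open>auto simp: closed_def\<close>)
      then obtain w where w: "set w \<subseteq> V" "length w \<le> 2 * card V - 1 - length [a, b]"
        "\<And>x. stable {} x \<Longrightarrow> (\<forall>v\<in>V. \<forall>j\<in>N v - V. x j) \<Longrightarrow> stable (V \<union> {}) (run w x)"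
        by blast
      \<comment> \<open>\<open>V\<close> is closed, so the condition on values from outside is
        vacuous.\<close>
      have "stable V (run w x)" for x
        using w(3)[of x] assms(2) by (auto simp: stable_def closed_def)
      then show ?thesis using w by (intro exI[of _ w]) simp
    qed
  qed
qed

lemma fixing_word_exists:
  assumes "finite V" "closed V" "card V \<ge> 3"
  shows "\<exists>w. set w \<subseteq> V \<and> length w \<le> 2 * card V - 2 \<and> (\<forall>x. stable V (run w x))"
  using short_fixing_word_or_looped_cycle[OF assms]
proof (elim disjE)
  assume "\<exists>w. set w \<subseteq> V \<and> length w \<le> 2 * card V - 3 \<and> (\<forall>x. stable V (run w x))"
  moreover have "2 * card V - 3 \<le> 2 * card V - 2" by simp
  ultimately show ?thesis using le_trans by blast
next
  assume *: "strong V \<and> (\<forall>v\<in>V. \<exists>p\<in>V. p \<noteq> v \<and> N v = {v, p})"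
  have "V \<noteq> {}" using assms(3) by auto
  then obtain r where r: "r \<in> V" by blast
  then have "N r \<inter> V \<noteq> {}" using * by blast
  then obtain w where w: "set w \<subseteq> V" "length w \<le> 2 * card V - 2"
      "\<And>x. stable {} x \<Longrightarrow> (\<forall>v\<in>V. \<forall>j\<in>N v - V. x j) \<Longrightarrow> stable (V \<union> {}) (run w x)"
    using component_fixing_word_short[of V r "{}"] assms(1) * r by (auto simp: closed_def)
  have "stable V (run w x)" for x
    using w(3)[of x] assms(2) by (auto simp: stable_def closed_def)
  then show ?thesis using w by blast
qed

section \<open>The directed cycle with all loops\<close>

text \<open>For a bijection \<open>\<sigma>\<close> onto the vertices, this is an isomorphism from
  the looped cycle to the graph of \<open>N\<close>; the conditional is the cyclic
  predecessor.\<close>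

definition looped_cycle :: "nat \<Rightarrow> (nat \<Rightarrow> nat) \<Rightarrow> bool" where
  "looped_cycle n \<sigma> \<longleftrightarrow> (\<forall>i\<in>{1..n}. N (\<sigma> i) = {\<sigma> i, \<sigma> (if i = 1 then n else i - 1)})"

text \<open>The cycle is enumerated by iterating the map that sends a vertex to its in-neighbor.\<close>

lemma looped_cycle_enumeration:
  assumes "finite V" "V \<noteq> {}" "strong V" "\<forall>v\<in>V. \<exists>p\<in>V. p \<noteq> v \<and> N v = {v, p}"
  shows "\<exists>\<sigma>. bij_betw \<sigma> {1..card V} V \<and> looped_cycle (card V) \<sigma>"
proof -
  obtain p where p: "\<And>v. v \<in> V \<Longrightarrow> p v \<in> V \<and> p v \<noteq> v \<and> N v = {v, p v}"
    using assms(4) by metis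
  obtain r where r: "r \<in> V" using assms(2) by blast
  define e where "e k = (p ^^ k) r" for k
  define n where "n = card V"
  have e_Suc: "e (Suc k) = p (e k)" for k by (simp add: e_def)
  have e_V: "e k \<in> V" for k by (induction k) (use r p e_def in auto)
  \<comment> \<open>The orbit contains all in-neighbors of its members, so no arc enters it.\<close>
  have range: "range e = V"
  proof (rule ccontr)
    assume "range e \<noteq> V"
    then obtain u v where "u \<in> V - range e" "v \<in> range e" "u \<in> N v"
      using strong_cut_into[OF assms(3), of "range e"] e_V by blast
    then show False using p[of v] e_V e_Suc by (metis DiffD2 empty_iff image_iff insert_iff rangeI)
  qed
  \<comment> \<open>A repetition at \<open>j\<close> traps the orbit among its first
    \<open>j\<close> values, and these must cover \<open>V\<close>.\<close>
  have repeat: "n \<le> j" if "e i = e j" "i < j" for i j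
  proof -
    have "e k \<in> e ` {..<j}" for k
    proof (induction k)
      case 0
      then show ?case using that by auto
    next
      case (Suc k)
      then obtain l where l: "l < j" "e k = e l" by auto
      have "e (Suc k) = e (Suc l)" using l(2) by (simp add: e_Suc)
      show ?case
      proof (cases "Suc l = j")
        case True
        then show ?thesis using \<open>e (Suc k) = e (Suc l)\<close> that by (metis imageI lessThan_iff)
      next
        case False
        then show ?thesis using \<open>e (Suc k) = e (Suc l)\<close> l(1) by auto
      qed
    qed
    then have "V \<subseteq> e ` {..<j}" using range by blast
    then have "n \<le> card (e ` {..<j})" unfolding n_def by (intro card_mono) auto
    also have "\<dots> \<le> j" using card_image_le[of "{..<j}" e] by simp
    finally show ?thesis .
  qed
  have inj: "inj_on e {..<n}"
  proof (rule inj_onI)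
    fix i j assume ij: "i \<in> {..<n}" "j \<in> {..<n}" "e i = e j"
    then show "i = j"
      using repeat[of i j] repeat[of j i] by (cases i j rule: linorder_cases) auto
  qed
  have img: "e ` {..<n} = V"
    by (rule card_subset_eq) (use assms(1) e_V card_image[OF inj] n_def in auto)
  \<comment> \<open>The orbit has no tail: \<open>r\<close> has an out-neighbor
    \<open>v = e m\<close> other than itself, so \<open>e (Suc m) = r\<close>, and
    \<open>repeat\<close> forces \<open>Suc m = n\<close>.\<close>
  have "V \<noteq> {r}" using p[OF r] by blast
  then obtain v where v: "v \<in> V" "v \<noteq> r" "r \<in> N v"
    using assms(3)[unfolded strong_def, rule_format, of "{r}"] r by auto
  have "r = p v" using p[OF v(1)] v(2,3) by auto
  obtain m where m: "m < n" "v = e m" using v(1) img by blast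
  have "e 0 = r" by (simp add: e_def)
  then have "e 0 = e (Suc m)" using \<open>r = p v\<close> m(2) e_Suc[of m] by metis
  then have "n = Suc m" using repeat[of 0 "Suc m"] m(1) by simp
  then have wrap: "e n = e 0" using \<open>e 0 = e (Suc m)\<close> by simp
  have bij: "bij_betw (\<lambda>i. n - i) {1..n} {..<n}"
    by (rule bij_betw_byWitness[where f' = "\<lambda>i. n - i"]) (use \<open>n = Suc m\<close> in auto)
  \<comment> \<open>\<open>e\<close> runs against the arcs, whence the reversed index;
    \<open>\<sigma> n\<close> is the start \<open>r\<close>.\<close>
  define \<sigma> where "\<sigma> i = e (n - i)" for i
  have "bij_betw \<sigma> {1..n} V"
    using bij_betw_trans[OF bij, of e V] inj img unfolding bij_betw_def \<sigma>_def o_def by blast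
  moreover have "looped_cycle n \<sigma>"
    unfolding looped_cycle_def
  proof
    fix i assume i: "i \<in> {1..n}"
    have "p (\<sigma> i) = e (Suc (n - i))" by (simp add: e_Suc \<sigma>_def)
    also have "\<dots> = \<sigma> (if i = 1 then n else i - 1)"
      using i wrap by (auto simp: \<sigma>_def Suc_diff_le[symmetric])
    finally show "N (\<sigma> i) = {\<sigma> i, \<sigma> (if i = 1 then n else i - 1)}"
      using p[of "\<sigma> i"] e_V \<sigma>_def by simp
  qed
  ultimately show ?thesis unfolding n_def by blast
qed

section \<open>Lower bound for the looped cycle\<close>

lemma looped_cycle_stable:
  assumes "looped_cycle n \<sigma>" "stable (\<sigma> ` {1..n}) z" "i \<in> {1..n}" "j \<in> {1..n}" "z (\<sigma> i)"
  shows "z (\<sigma> j)"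
proof -
  have pred: "z (\<sigma> (if k = 1 then n else k - 1))" if "k \<in> {1..n}" "z (\<sigma> k)" for k
    using assms(1,2) that unfolding looped_cycle_def stable_def by blast
  have down: "z (\<sigma> k)" if "k \<le> l" "l \<le> n" "z (\<sigma> l)" "1 \<le> k" for k l
    using that
  proof (induction l rule: dec_induct)
    case (step l)
    then show ?case using pred[of "Suc l"] by (auto split: if_splits)
  qed simp
  \<comment> \<open>Ones propagate backwards from \<open>i\<close> to \<open>1\<close>, around to
    \<open>n\<close>, and down to \<open>j\<close>: stable configurations are constant.\<close>
  have "z (\<sigma> 1)" using down[of 1 i] assms by simp
  then have "z (\<sigma> n)" using pred[of 1] assms(3) by simp
  then show ?thesis using down[of j n] assms by simp
qed

text \<open>A zero placed at \<open>c\<close> has to travel through \<open>a\<close> before it reaches \<open>b\<close>.\<close>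

lemma run_blocked:
  assumes "a \<notin> set w1" "b \<notin> set w2" "B \<subseteq> A" "b \<in> B" "c \<notin> A" "c \<in> N c"
    and "\<forall>v\<in>A - {a}. N v \<subseteq> A" "\<forall>v\<in>B - {b}. N v \<subseteq> B"
  shows "run (w1 @ w2) (\<lambda>v. v \<noteq> c) b \<and> \<not> run (w1 @ w2) (\<lambda>v. v \<noteq> c) c"
proof
  \<comment> \<open>The ones on \<open>A\<close> survive \<open>w1\<close>, which lacks
    \<open>a\<close>; those on \<open>B\<close> then survive \<open>w2\<close>, which lacks
    \<open>b\<close>.\<close>
  have "\<forall>v\<in>A. run w1 (\<lambda>v. v \<noteq> c) v"
    by (rule run_ones) (use assms in auto)
  then have "\<forall>v\<in>B. run w1 (\<lambda>v. v \<noteq> c) v" using assms(3) by blast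
  then have "\<forall>v\<in>B. run w2 (run w1 (\<lambda>v. v \<noteq> c)) v"
    by (rule run_ones) (use assms in auto)
  then show "run (w1 @ w2) (\<lambda>v. v \<noteq> c) b" using assms(4) by simp
  have "\<forall>v\<in>{c}. \<not> run (w1 @ w2) (\<lambda>v. v \<noteq> c) v"
    by (rule run_zeros) (use assms(6) in auto)
  then show "\<not> run (w1 @ w2) (\<lambda>v. v \<noteq> c) c" by blast
qed

lemma looped_cycle_arc:
  assumes "looped_cycle n \<sigma>" "I \<subseteq> {1..n}" "\<forall>i\<in>I - {a}. (if i = 1 then n else i - 1) \<in> I"
  shows "\<forall>v\<in>\<sigma> ` I - {\<sigma> a}. N v \<subseteq> \<sigma> ` I"
proof
  fix v assume "v \<in> \<sigma> ` I - {\<sigma> a}"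
  then obtain i where i: "i \<in> I - {a}" "v = \<sigma> i" by blast
  then have "N v = {\<sigma> i, \<sigma> (if i = 1 then n else i - 1)}"
    using assms(1,2) unfolding looped_cycle_def by blast
  then show "N v \<subseteq> \<sigma> ` I" using assms(3) i by blast
qed

text \<open>Otherwise the zero at \<open>\<sigma> c\<close> persists without reaching
  \<open>\<sigma> b\<close>, and the final configuration is not constant.\<close>

lemma looped_cycle_blocked:
  assumes "looped_cycle n \<sigma>" "inj_on \<sigma> {1..n}" "\<forall>x. stable (\<sigma> ` {1..n}) (run (w1 @ w2) x)"
    and "B \<subseteq> A" "A \<subseteq> {1..n}" "b \<in> B" "c \<in> {1..n} - A"
    and "\<forall>i\<in>A - {a}. (if i = 1 then n else i - 1) \<in> A"
    and "\<forall>i\<in>B - {b}. (if i = 1 then n else i - 1) \<in> B"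
  shows "\<sigma> a \<in> set w1 \<or> \<sigma> b \<in> set w2"
proof (rule ccontr)
  assume "\<not> (\<sigma> a \<in> set w1 \<or> \<sigma> b \<in> set w2)"
  moreover have "\<sigma> c \<in> N (\<sigma> c)" using assms(1,7) unfolding looped_cycle_def by blast
  moreover have "\<sigma> c \<notin> \<sigma> ` A" using assms(2,5,7) by (auto dest: inj_onD)
  moreover have "\<forall>v\<in>\<sigma> ` A - {\<sigma> a}. N v \<subseteq> \<sigma> ` A" "\<forall>v\<in>\<sigma> ` B - {\<sigma> b}. N v \<subseteq> \<sigma> ` B"
    using looped_cycle_arc[OF assms(1)] assms(4,5,8,9) by auto
  ultimately have "run (w1 @ w2) (\<lambda>v. v \<noteq> \<sigma> c) (\<sigma> b)" "\<not> run (w1 @ w2) (\<lambda>v. v \<noteq> \<sigma> c) (\<sigma> c)"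
    using run_blocked[of "\<sigma> a" w1 "\<sigma> b" w2 "\<sigma> ` B" "\<sigma> ` A" "\<sigma> c"] assms(4,6) image_mono[OF assms(4), of \<sigma>] by blast+
  then show False
    using looped_cycle_stable[OF assms(1) assms(3)[rule_format]] assms(4-7) by blast
qed

text \<open>Cut \<open>w\<close> just before position \<open>pa\<close>: the first part lacks
  \<open>\<sigma> a\<close>, and if \<open>pb < pa\<close>, the second lacks
  \<open>\<sigma> b\<close>.\<close>

lemma looped_cycle_before:
  assumes "looped_cycle n \<sigma>" "inj_on \<sigma> {1..n}" "\<forall>x. stable (\<sigma> ` {1..n}) (run w x)"
    and "B \<subseteq> A" "A \<subseteq> {1..n}" "b \<in> B" "c \<in> {1..n} - A"
    and "\<forall>i\<in>A - {a}. (if i = 1 then n else i - 1) \<in> A"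
    and "\<forall>i\<in>B - {b}. (if i = 1 then n else i - 1) \<in> B"
    and "\<forall>k<length w. w ! k = \<sigma> a \<longrightarrow> k = pa" "\<forall>k<length w. w ! k = \<sigma> b \<longrightarrow> k = pb"
  shows "pa \<le> pb"
proof (rule ccontr)
  assume "\<not> pa \<le> pb"
  have "\<sigma> a \<notin> set (take pa w)"
    using assms(10) by (auto simp: in_set_conv_nth)
  moreover have "\<sigma> b \<notin> set (drop pa w)"
  proof
    assume "\<sigma> b \<in> set (drop pa w)"
    then obtain i where "pa + i < length w" "w ! (pa + i) = \<sigma> b"
      unfolding in_set_conv_nth by force
    then show False using assms(11) \<open>\<not> pa \<le> pb\<close> by (metis le_add1)
  qed
  ultimately show False
    using looped_cycle_blocked[OF assms(1,2) _ assms(4-9), of "take pa w" "drop pa w"] assms(3)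
    by simp
qed

lemma looped_cycle_letters:
  assumes "looped_cycle n \<sigma>" "inj_on \<sigma> {1..n}" "n \<ge> 2" "\<forall>x. stable (\<sigma> ` {1..n}) (run w x)"
    and "i \<in> {1..n}"
  shows "\<sigma> i \<in> set w"
proof -
  define j where "j = (if i = 1 then n else i - 1)"
  \<comment> \<open>The zero starts at the predecessor \<open>j\<close>, which differs from
    \<open>i\<close> as \<open>n \<ge> 2\<close>.\<close>
  have "\<sigma> i \<in> set w \<or> \<sigma> i \<in> set []"
    by (rule looped_cycle_blocked[of n \<sigma> w "[]" "{i}" "{i}" i j i])
      (use assms j_def in auto)
  then show ?thesis by simp
qed

lemma count_list_1_position:
  assumes "count_list w v = 1"
  shows "\<exists>p<length w. w ! p = v \<and> (\<forall>k<length w. w ! k = v \<longrightarrow> k = p)"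
proof -
  have "card {k. k < length w \<and> v = w ! k} = 1"
    using assms by (simp add: count_list_eq_length_filter length_filter_conv_card)
  then obtain p where "{k. k < length w \<and> v = w ! k} = {p}" by (rule card_1_singletonE)
  then have "k < length w \<and> v = w ! k \<longleftrightarrow> k = p" for k by (simp add: set_eq_iff)
  then show ?thesis by metis
qed

lemma looped_cycle_fixing_length:
  assumes cyc: "looped_cycle n \<sigma>" and inj: "inj_on \<sigma> {1..n}" and "n \<ge> 2"
    and w: "set w \<subseteq> \<sigma> ` {1..n}" and stab: "\<forall>x. stable (\<sigma> ` {1..n}) (run w x)"
  shows "2 * n - 2 \<le> length w"
proof (rule ccontr)
  assume short: "\<not> 2 * n - 2 \<le> length w"
  define K where "K = {i\<in>{1..n}. count_list w (\<sigma> i) = 1}"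
  have K: "finite K" "K \<subseteq> {1..n}" unfolding K_def by auto
  \<comment> \<open>Letters outside \<open>K\<close> occur at least twice, so \<open>2 * n\<close>
    is at most \<open>length w + card K\<close>.\<close>
  have "2 * n = (\<Sum>i\<in>{1..n}. 2)" by simp
  also have "\<dots> \<le> (\<Sum>i\<in>{1..n}. count_list w (\<sigma> i) + (if i \<in> K then 1 else 0))"
  proof (rule sum_mono)
    fix i assume i: "i \<in> {1..n}"
    have "count_list w (\<sigma> i) \<noteq> 0"
      using looped_cycle_letters[OF cyc inj \<open>n \<ge> 2\<close> stab i] by (simp add: count_list_0_iff)
    then show "2 \<le> count_list w (\<sigma> i) + (if i \<in> K then 1 else 0)"
      using i unfolding K_def by auto
  qed
  also have "\<dots> = (\<Sum>i\<in>{1..n}. count_list w (\<sigma> i)) + card K"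
    using K by (simp add: sum.distrib sum.If_cases Int_absorb1)
  also have "(\<Sum>i\<in>{1..n}. count_list w (\<sigma> i)) = length w"
    using sum.reindex[OF inj, of "count_list w"] sum_count_set[OF w] by simp
  finally have "card K \<ge> 3" using short by linarith
  define a where "a = Min K"
  define c where "c = Max K"
  have "K \<noteq> {}" using \<open>card K \<ge> 3\<close> by auto
  then have ac: "a \<in> K" "c \<in> K" unfolding a_def c_def using K(1) by auto
  have "card {a, c} \<le> 2" by (simp add: card_insert_if)
  then have "\<not> K \<subseteq> {a, c}" using \<open>card K \<ge> 3\<close> card_mono[of "{a, c}" K] by auto
  then obtain b where b: "b \<in> K" "b \<noteq> a" "b \<noteq> c" by blast
  have "a \<le> b" "b \<le> c" using b(1) K(1) unfolding a_def c_def by auto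
  then have ord: "1 \<le> a" "a < b" "b < c" "c \<le> n" using b ac K(2) by auto
  have "\<forall>i\<in>K. \<exists>p. p < length w \<and> w ! p = \<sigma> i \<and> (\<forall>k<length w. w ! k = \<sigma> i \<longrightarrow> k = p)"
    using count_list_1_position[of w] unfolding K_def by blast
  from bchoice[OF this] obtain q where q: "\<And>i. i \<in> K \<Longrightarrow> q i < length w \<and> w ! q i = \<sigma> i"
      "\<And>i. i \<in> K \<Longrightarrow> \<forall>k<length w. w ! k = \<sigma> i \<longrightarrow> k = q i"
    by blast
  \<comment> \<open>Three rotations of one argument, with the zero at \<open>c\<close>,
    \<open>a\<close>, \<open>b\<close> in turn. \<open>A\<close> and \<open>B\<close> are the arcs
    from the first and from the second relay up to just before the zero; arcs passing
    \<open>n\<close> are unions of two intervals.\<close>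
  have "q a \<le> q b"
    by (rule looped_cycle_before[OF cyc inj stab, where a = a and b = b and A = "{a..<c}" and B = "{b..<c}" and c = c])
      (use ord q(2) ac b in auto)
  moreover have "q b \<le> q c"
    by (rule looped_cycle_before[OF cyc inj stab, where a = b and b = c
          and A = "{b..n} \<union> {1..<a}" and B = "{c..n} \<union> {1..<a}" and c = a])
      (use ord q(2) ac b in auto)
  moreover have "q c \<le> q a"
    by (rule looped_cycle_before[OF cyc inj stab, where a = c and b = a
          and A = "{c..n} \<union> {1..<b}" and B = "{a..<b}" and c = b])
      (use ord q(2) ac b in auto)
  ultimately have "q a = q b" by linarith
  then have "\<sigma> a = \<sigma> b" using q(1)[OF ac(1)] q(1)[OF b(1)] by metis
  then show False using inj b ac K(2) by (metis inj_onD subsetD)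
qed

text \<open>Lets arbitrary functions stand in for extensional configurations: updates in a closed
  set never read values outside it.\<close>

lemma run_cong:
  assumes "closed V" "\<forall>j\<in>V. x j = y j"
  shows "\<forall>j\<in>V. run w x j = run w y j"
  using assms(2)
proof (induction w arbitrary: x y)
  case (Cons v w)
  have "upd v x j = upd v y j" if "j \<in> V" for j
  proof (cases "j = v")
    case True
    then have "N v \<subseteq> V" using that assms(1) closed_def by blast
    then show ?thesis using True Cons.prems by (auto simp: upd_same)
  next
    case False
    then show ?thesis using Cons.prems that by (simp add: upd_other)
  qed
  then show ?case using Cons.IH[of "upd v x" "upd v y"] by simp
qed simp

end

section \<open>Networks and their interaction graphs\<close>

text \<open>An arc of a pair digraph is the pair of its ends, so the vertex map of an isomorphism
  forces its arc map.\<close>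

lemma digraph_iso_with_proj:
  assumes "pair_wf_digraph G"
  shows "digraph_iso (with_proj G) (with_proj H) \<longleftrightarrow>
    (\<exists>h. inj_on h (pverts G) \<and> pverts H = h ` pverts G \<and> parcs H = map_prod h h ` parcs G)"
proof
  assume "digraph_iso (with_proj G) (with_proj H)"
  then obtain m where iso: "pre_digraph.digraph_isomorphism (with_proj G) m"
    and app: "with_proj H = app_iso m (with_proj G)"
    unfolding digraph_iso_def by blast
  have "iso_head m = snd" "iso_tail m = fst"
    using arg_cong[OF app, of head] arg_cong[OF app, of tail] by simp_all
  then have arc: "iso_arcs m a = map_prod (iso_verts m) (iso_verts m) a" if "a \<in> parcs G" for a
    using iso that unfolding pre_digraph.digraph_isomorphism_def by (simp add: prod_eq_iff)
  show "\<exists>h. inj_on h (pverts G) \<and> pverts H = h ` pverts G \<and> parcs H = map_prod h h ` parcs G"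
  proof (intro exI conjI)
    show "inj_on (iso_verts m) (pverts G)"
      using iso unfolding pre_digraph.digraph_isomorphism_def by simp
    show "pverts H = iso_verts m ` pverts G" using arg_cong[OF app, of verts] by simp
    have "parcs H = iso_arcs m ` parcs G" using arg_cong[OF app, of arcs] by simp
    also have "\<dots> = map_prod (iso_verts m) (iso_verts m) ` parcs G"
      by (rule image_cong) (use arc in simp_all)
    finally show "parcs H = map_prod (iso_verts m) (iso_verts m) ` parcs G" .
  qed
next
  assume "\<exists>h. inj_on h (pverts G) \<and> pverts H = h ` pverts G \<and> parcs H = map_prod h h ` parcs G"
  then obtain h where h: "inj_on h (pverts G)" "pverts H = h ` pverts G"
    "parcs H = map_prod h h ` parcs G" by blast
  have "parcs G \<subseteq> pverts G \<times> pverts G"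
    using pair_wf_digraph.arc_fst_in_verts[OF assms] pair_wf_digraph.arc_snd_in_verts[OF assms]
    by (auto simp: mem_Times_iff)
  then have inj: "inj_on (map_prod h h) (parcs G)"
    using map_prod_inj_on[OF h(1) h(1)] inj_on_subset by blast
  let ?m = "\<lparr>iso_verts = h, iso_arcs = map_prod h h, iso_head = snd, iso_tail = fst\<rparr>"
  have "pre_digraph.digraph_isomorphism (with_proj G) ?m"
    unfolding pre_digraph.digraph_isomorphism_def using assms h(1) inj
    by (simp add: wf_digraph_wp_iff)
  moreover have "with_proj H = app_iso ?m (with_proj G)"
    unfolding with_proj_def app_iso_def using h by simp
  ultimately show "digraph_iso (with_proj G) (with_proj H)" unfolding digraph_iso_def by blast
qed

lemma parcs_looped_directed_cycle:
  assumes "n \<ge> 1"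
  shows "parcs (looped_directed_cycle n) =
    {(j, i). i \<in> {1..n} \<and> j \<in> {i, if i = 1 then n else i - 1}}"
proof (intro set_eqI)
  fix a :: "nat \<times> nat"
  obtain j i where a: "a = (j, i)" by fastforce
  show "a \<in> parcs (looped_directed_cycle n) \<longleftrightarrow>
      a \<in> {(j, i). i \<in> {1..n} \<and> j \<in> {i, if i = 1 then n else i - 1}}"
    unfolding a looped_directed_cycle_def directed_cycle_def using assms by auto
qed

lemma interaction_graph_conj:
  assumes "\<And>i. i \<in> {1..n} \<Longrightarrow> J i \<subseteq> {1..n}"
    and "\<And>i x. i \<in> {1..n} \<Longrightarrow> x \<in> configs n \<Longrightarrow> f x i = conj_map J x i"
  shows "interaction_graph n f = \<lparr>pverts = {1..n}, parcs = {(j, i). i \<in> {1..n} \<and> j \<in> J i}\<rparr>"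
proof -
  have "depends_on n f i j \<longleftrightarrow> j \<in> J i" if ij: "i \<in> {1..n}" "j \<in> {1..n}" for i j
  proof
    assume "depends_on n f i j"
    then obtain x y where xy: "x \<in> configs n" "y \<in> configs n" "\<forall>k\<in>{1..n} - {j}. x k = y k"
        "f x i \<noteq> f y i"
      unfolding depends_on_def by blast
    then have "conj_map J x i \<noteq> conj_map J y i" using assms(2) ij by simp
    then show "j \<in> J i" using xy(3) assms(1)[OF ij(1)] unfolding conj_map_def by blast
  next
    assume j: "j \<in> J i"
    \<comment> \<open>All ones against a single zero at \<open>j\<close>: exactly the conjunctions
      containing \<open>j\<close> notice.\<close>
    let ?x = "restrict (\<lambda>_. True) {1..n}"
    let ?y = "restrict (\<lambda>k. k \<noteq> j) {1..n}"
    have conf: "?x \<in> configs n" "?y \<in> configs n" unfolding configs_def by auto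
    have "conj_map J ?x i" using assms(1)[OF ij(1)] unfolding conj_map_def by auto
    moreover have "\<not> conj_map J ?y i"
      using j ij(2) unfolding conj_map_def by (intro notI) (drule bspec[of _ _ j], auto)
    ultimately have "f ?x i \<noteq> f ?y i" using assms(2)[OF ij(1)] conf by simp
    moreover have "?x j \<noteq> ?y j" "\<forall>k\<in>{1..n} - {j}. ?x k = ?y k" using ij by auto
    ultimately show "depends_on n f i j" unfolding depends_on_def using conf by blast
  qed
  then have "{(j, i). j \<in> {1..n} \<and> i \<in> {1..n} \<and> depends_on n f i j} =
      {(j, i). i \<in> {1..n} \<and> j \<in> J i}"
    using assms(1) by blast
  then show ?thesis unfolding interaction_graph_def by simp
qed

lemma digraph_iso_looped_directed_cycle_iff:
  assumes "n \<ge> 1" "\<And>i. i \<in> {1..n} \<Longrightarrow> J i \<subseteq> {1..n}"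
    and G: "G = \<lparr>pverts = {1..n}, parcs = {(j, i). i \<in> {1..n} \<and> j \<in> J i}\<rparr>"
  shows "digraph_iso (with_proj G) (with_proj (looped_directed_cycle n)) \<longleftrightarrow>
    (\<exists>\<sigma>. bij_betw \<sigma> {1..n} {1..n} \<and> conjunctive.looped_cycle J n \<sigma>)"
proof -
  have verts: "pverts (looped_directed_cycle n) = {1..n}"
    by (simp add: looped_directed_cycle_def)
  have wf_C: "pair_wf_digraph (looped_directed_cycle n)"
    by unfold_locales (use assms(1) in \<open>auto simp: parcs_looped_directed_cycle verts split: if_splits\<close>)
  have wf_G: "pair_wf_digraph G"
    by unfold_locales (use assms(2) G in fastforce)+
  have arcs_iff: "parcs G = map_prod \<sigma> \<sigma> ` parcs (looped_directed_cycle n) \<longleftrightarrow>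
    conjunctive.looped_cycle J n \<sigma>" if \<sigma>: "inj_on \<sigma> {1..n}" "{1..n} = \<sigma> ` {1..n}" for \<sigma>
  proof -
    have arc: "(u, \<sigma> i) \<in> map_prod \<sigma> \<sigma> ` parcs (looped_directed_cycle n) \<longleftrightarrow>
      u \<in> {\<sigma> i, \<sigma> (if i = 1 then n else i - 1)}" if i: "i \<in> {1..n}" for u i
    proof
      assume "(u, \<sigma> i) \<in> map_prod \<sigma> \<sigma> ` parcs (looped_directed_cycle n)"
      then obtain j k where k: "k \<in> {1..n}" "j \<in> {k, if k = 1 then n else k - 1}" "u = \<sigma> j" "\<sigma> i = \<sigma> k"
        unfolding parcs_looped_directed_cycle[OF assms(1)] by auto
      then have "i = k" using \<sigma>(1) i by (simp add: inj_on_eq_iff)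
      then show "u \<in> {\<sigma> i, \<sigma> (if i = 1 then n else i - 1)}" using k by auto
    next
      assume "u \<in> {\<sigma> i, \<sigma> (if i = 1 then n else i - 1)}"
      then obtain j where j: "j \<in> {i, if i = 1 then n else i - 1}" "u = \<sigma> j" by blast
      then have "(j, i) \<in> parcs (looped_directed_cycle n)"
        unfolding parcs_looped_directed_cycle[OF assms(1)] using i by simp
      then have "map_prod \<sigma> \<sigma> (j, i) \<in> map_prod \<sigma> \<sigma> ` parcs (looped_directed_cycle n)"
        by (rule imageI)
      then show "(u, \<sigma> i) \<in> map_prod \<sigma> \<sigma> ` parcs (looped_directed_cycle n)" using j by simp
    qed
    have arcG: "(u, \<sigma> i) \<in> parcs G \<longleftrightarrow> u \<in> J (\<sigma> i)" if "i \<in> {1..n}" for u i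
      using \<sigma>(2) that unfolding G by auto
    have snd: "snd a \<in> \<sigma> ` {1..n}"
      if "a \<in> parcs G \<union> map_prod \<sigma> \<sigma> ` parcs (looped_directed_cycle n)" for a
      using that \<sigma>(2) unfolding G parcs_looped_directed_cycle[OF assms(1)] by auto
    show ?thesis
    proof
      assume eq: "parcs G = map_prod \<sigma> \<sigma> ` parcs (looped_directed_cycle n)"
      show "conjunctive.looped_cycle J n \<sigma>"
        unfolding conjunctive.looped_cycle_def
      proof (intro ballI set_eqI)
        fix i u assume "i \<in> {1..n}"
        then show "u \<in> J (\<sigma> i) \<longleftrightarrow> u \<in> {\<sigma> i, \<sigma> (if i = 1 then n else i - 1)}"
          using arc arcG eq by metis
      qed
    next
      assume cyc: "conjunctive.looped_cycle J n \<sigma>"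
      have arcs_eq: "(u, \<sigma> i) \<in> parcs G \<longleftrightarrow> (u, \<sigma> i) \<in> map_prod \<sigma> \<sigma> ` parcs (looped_directed_cycle n)"
        if "i \<in> {1..n}" for u i
        using arc[OF that, of u] arcG[OF that, of u]
          cyc[unfolded conjunctive.looped_cycle_def, rule_format, OF that] by metis
      have "a \<in> parcs G \<longleftrightarrow> a \<in> map_prod \<sigma> \<sigma> ` parcs (looped_directed_cycle n)" for a
      proof (cases "snd a \<in> \<sigma> ` {1..n}")
        case True
        then obtain i where "i \<in> {1..n}" "a = (fst a, \<sigma> i)" by (metis imageE prod.collapse)
        then show ?thesis using arcs_eq by metis
      next
        case False
        then show ?thesis using snd[of a] by blast
      qed
      then show "parcs G = map_prod \<sigma> \<sigma> ` parcs (looped_directed_cycle n)" by blast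
    qed
  qed
  \<comment> \<open>\<open>\<sigma>\<close> maps the standard cycle to \<open>G\<close>, so the
    isomorphism is reversed first.\<close>
  have "digraph_iso (with_proj G) (with_proj (looped_directed_cycle n)) \<longleftrightarrow>
    digraph_iso (with_proj (looped_directed_cycle n)) (with_proj G)"
    using digraph_iso_swap wf_C wf_G by (metis wf_digraph_wp_iff)
  also have "\<dots> \<longleftrightarrow> (\<exists>\<sigma>. inj_on \<sigma> {1..n} \<and> {1..n} = \<sigma> ` {1..n} \<and>
      parcs G = map_prod \<sigma> \<sigma> ` parcs (looped_directed_cycle n))"
    unfolding digraph_iso_with_proj[OF wf_C] verts G by simp
  also have "\<dots> \<longleftrightarrow> (\<exists>\<sigma>. bij_betw \<sigma> {1..n} {1..n} \<and> conjunctive.looped_cycle J n \<sigma>)"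
    unfolding bij_betw_def using arcs_iff by metis
  finally show ?thesis .
qed

section \<open>Words of \<open>f\<close> and words of its conjunctive map\<close>

lemma update_word_conj:
  assumes "\<And>i x. i \<in> {1..n} \<Longrightarrow> x \<in> configs n \<Longrightarrow> f x i = conj_map J x i"
    and "set w \<subseteq> {1..n}" "x \<in> configs n"
  shows "update_word f w x = update_word (conj_map J) w x \<and> update_word f w x \<in> configs n"
  using assms(2,3)
proof (induction w arbitrary: x)
  case Nil
  then show ?case by (simp add: update_word_def)
next
  case (Cons i w)
  have "update f i x = update (conj_map J) i x" "update f i x \<in> configs n"
    using Cons.prems assms(1) by (auto simp: update_def configs_def PiE_def extensional_def)
  moreover have "update_word g (i # w) x = update_word g w (update g i x)" for g
    by (simp add: update_word_def)
  moreover have "set w \<subseteq> {1..n}" using Cons.prems(1) by simp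
  ultimately show ?case using Cons.IH[of "update f i x"] by metis
qed

lemma fixing_word_iff_stable:
  assumes "network n f" "\<And>i. i \<in> {1..n} \<Longrightarrow> J i \<subseteq> {1..n}"
    and f: "\<And>i x. i \<in> {1..n} \<Longrightarrow> x \<in> configs n \<Longrightarrow> f x i = conj_map J x i"
  shows "fixing_word n f w \<longleftrightarrow> set w \<subseteq> {1..n} \<and>
    (\<forall>x. conjunctive.stable J {1..n} (update_word (conj_map J) w x))"
proof -
  interpret conjunctive J .
  have fixed: "f y = y \<longleftrightarrow> stable {1..n} y" if y: "y \<in> configs n" for y
  proof -
    have "f y \<in> configs n" using assms(1) y unfolding network_def by blast
    then have "f y \<in> extensional {1..n}" "y \<in> extensional {1..n}"
      using y unfolding configs_def PiE_def by auto
    then have "f y = y \<longleftrightarrow> (\<forall>i\<in>{1..n}. f y i = y i)"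
      using extensionalityI[of "f y" "{1..n}" y] by metis
    also have "\<dots> \<longleftrightarrow> stable {1..n} y"
      unfolding stable_def using f y by (auto simp: conj_map_def)
    finally show ?thesis .
  qed
  have closed: "closed {1..n}" using assms(2) unfolding closed_def by blast
  have "(\<forall>x\<in>configs n. f (update_word f w x) = update_word f w x) \<longleftrightarrow>
    (\<forall>x. stable {1..n} (run w x))" if w: "set w \<subseteq> {1..n}"
  proof -
    have eq: "update_word f w x = run w x" "run w x \<in> configs n" if "x \<in> configs n" for x
      using update_word_conj[OF f w that] by auto
    show ?thesis
    proof
      assume *: "\<forall>x\<in>configs n. f (update_word f w x) = update_word f w x"
      show "\<forall>x. stable {1..n} (run w x)"
      proof
        fix x :: "nat \<Rightarrow> bool"
        \<comment> \<open>The restriction is a configuration and agrees with \<open>x\<close> on the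
          closed set \<open>{1..n}\<close>.\<close>
        let ?x = "restrict x {1..n}"
        have "?x \<in> configs n" unfolding configs_def by auto
        then have "stable {1..n} (run w ?x)"
          using * eq[of ?x] fixed[of "run w ?x"] by auto
        moreover have "\<forall>j\<in>{1..n}. run w x j = run w ?x j"
          by (rule run_cong[OF closed]) simp
        ultimately show "stable {1..n} (run w x)" using stable_cong closed by blast
      qed
    next
      assume "\<forall>x. stable {1..n} (run w x)"
      then show "\<forall>x\<in>configs n. f (update_word f w x) = update_word f w x"
        using eq fixed by auto
    qed
  qed
  then show ?thesis unfolding fixing_word_def by blast
qed

theorem theorem12:
  fixes n :: nat and f :: "(nat \<Rightarrow> bool) \<Rightarrow> nat \<Rightarrow> bool"
  assumes "n \<ge> 3" and "conjunctive_network n f"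
  shows "fixing_length n f \<le> enat (2 * n - 2) \<and>
    (fixing_length n f = enat (2 * n - 2) \<longleftrightarrow>
       digraph_iso (with_proj (interaction_graph n f)) (with_proj (looped_directed_cycle n)))"
proof -
  obtain J where J: "\<And>i. i \<in> {1..n} \<Longrightarrow> J i \<subseteq> {1..n}"
    and f: "\<And>i x. i \<in> {1..n} \<Longrightarrow> x \<in> configs n \<Longrightarrow> f x i = conj_map J x i"
    using assms(2) unfolding conjunctive_network_def conj_map_def by metis
  interpret conjunctive J .
  have net: "network n f" using assms(2) unfolding conjunctive_network_def by blast
  note word = fixing_word_iff_stable[OF net J f]
  have closed: "closed {1..n}" using J unfolding closed_def by blast
  let ?iso = "digraph_iso (with_proj (interaction_graph n f)) (with_proj (looped_directed_cycle n))"
  have iso: "?iso \<longleftrightarrow> (\<exists>\<sigma>. bij_betw \<sigma> {1..n} {1..n} \<and> looped_cycle n \<sigma>)"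
    by (rule digraph_iso_looped_directed_cycle_iff[OF _ J interaction_graph_conj[OF J f]])
      (use assms(1) in auto)
  have le: "fixing_length n f \<le> enat k" if "fixing_word n f w" "length w \<le> k" for w k
    unfolding fixing_length_def by (rule INF_lower2[of w]) (use that in auto)
  have upper: "fixing_length n f \<le> enat (2 * n - 2)"
    using fixing_word_exists[of "{1..n}"] closed assms(1) le word by auto
  have lower: "enat (2 * n - 2) \<le> fixing_length n f" if ex: ?iso
  proof -
    obtain \<sigma> where \<sigma>: "bij_betw \<sigma> {1..n} {1..n}" "looped_cycle n \<sigma>" using ex iso by blast
    show ?thesis
      unfolding fixing_length_def
    proof (rule INF_greatest)
      fix w assume "w \<in> {w. fixing_word n f w}"
      then have "set w \<subseteq> \<sigma> ` {1..n}" "\<forall>x. stable (\<sigma> ` {1..n}) (run w x)"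
        using word \<sigma>(1) by (auto simp: bij_betw_def)
      then show "enat (2 * n - 2) \<le> enat (length w)"
        using looped_cycle_fixing_length[OF \<sigma>(2)] \<sigma>(1) assms(1) by (auto simp: bij_betw_def)
    qed
  qed
  have "fixing_length n f < enat (2 * n - 2)" if "\<not> ?iso"
  proof -
    \<comment> \<open>The exceptional case of the dichotomy would enumerate the looped cycle and
      give an isomorphism.\<close>
    have "\<not> (strong {1..n} \<and> (\<forall>v\<in>{1..n}. \<exists>p\<in>{1..n}. p \<noteq> v \<and> J v = {v, p}))"
    proof
      assume "strong {1..n} \<and> (\<forall>v\<in>{1..n}. \<exists>p\<in>{1..n}. p \<noteq> v \<and> J v = {v, p})"
      moreover have "{1..n} \<noteq> {}" "card {1..n} = n" using assms(1) by auto
      ultimately show False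
        using looped_cycle_enumeration[of "{1..n}"] that iso by (metis finite_atLeastAtMost)
    qed
    then obtain w where "set w \<subseteq> {1..n}" "length w \<le> 2 * n - 3" "\<forall>x. stable {1..n} (run w x)"
      using short_fixing_word_or_looped_cycle[of "{1..n}"] closed assms(1) by auto
    then have "fixing_length n f \<le> enat (2 * n - 3)" using le word by blast
    \<comment> \<open>Strict despite truncated subtraction, as \<open>2 * n - 2\<close> is
      positive.\<close>
    also have "\<dots> < enat (2 * n - 2)" using assms(1) by simp
    finally show ?thesis .
  qed
  then show ?thesis using upper lower by (metis order_antisym less_irrefl)
qed

end
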